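(* The function $$g(x) := \frac{\mathrm{e}^x}{x\, (I_0(x) - 1)}$$ is monotonically decreasing for $x \ge 1$.
   Context: $I_0$ denotes the modified Bessel function of the first kind of order zero. *)

theory Defs
  imports Complex_Main
begin

text \<open>
  The modified Bessel function of the first kind of order zero,
  given on the real line by its everywhere convergent power series
  (lemma \<open>summable_bessel_I0\<close> below justifies the use of \<^const>\<open>suminf\<close>).
\<close>

definition bessel_I0 :: "real \<Rightarrow> real" where
  "bessel_I0 x = (\<Sum>k. (x / 2) ^ (2 * k) / (fact k)\<^sup>2)"

lemma summable_bessel_I0: "summable (\<lambda>k. (x / 2) ^ (2 * k) / (fact k)\<^sup>2 :: real)"
proof (rule summable_comparison_test')
  show "summable (\<lambda>k. inverse (fact k) * ((x / 2)\<^sup>2) ^ k)"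
    by (rule summable_exp)
next
  fix k :: nat
  have "(fact k :: real) \<le> (fact k)\<^sup>2"
    using fact_ge_1[of k, where 'a = real] by (simp add: power2_eq_square)
  then have "((x / 2)\<^sup>2) ^ k / (fact k)\<^sup>2 \<le> ((x / 2)\<^sup>2) ^ k / fact k"
    by (intro divide_left_mono mult_pos_pos) simp_all
  moreover have "norm ((x / 2) ^ (2 * k) / (fact k)\<^sup>2) = ((x / 2)\<^sup>2) ^ k / (fact k)\<^sup>2"
    unfolding power_mult real_norm_def by (rule abs_of_nonneg) (intro divide_nonneg_nonneg zero_le_power zero_le_power2)
  moreover have "((x / 2)\<^sup>2) ^ k / fact k = inverse (fact k) * ((x / 2)\<^sup>2) ^ k"
    by (rule divide_inverse_commute)
  ultimately show "norm ((x / 2) ^ (2 * k) / (fact k)\<^sup>2) \<le> inverse (fact k) * ((x / 2)\<^sup>2) ^ k"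
    by (simp only:)
qed

end

theory Submission imports Defs begin

text \<open>
  The claim is that the reciprocal \<open>h x = x * (I\<^sub>0 x - 1) * exp (- x)\<close> increases. Its derivative is
  \<open>exp (- x)\<close> times \<open>(I\<^sub>0 x - 1) + x * I\<^sub>1 x - x * (I\<^sub>0 x - 1)\<close>, where \<open>I\<^sub>1 = I\<^sub>0'\<close>, so everything
  reduces to
  \<open>x * (I\<^sub>0 x - 1) \<le> (I\<^sub>0 x - 1) + x * I\<^sub>1 x\<close> (lemma \<open>mult_bessel_I0_minus_1_le\<close>).
  Let \<open>u\<^sub>k = (x/2)\<^bsup>2(k+1)\<^esup> / ((k+1)!)\<^sup>2\<close> be the terms of \<open>I\<^sub>0 x - 1\<close>. The right-hand side is the sum of
  \<open>(2k + 3) u\<^sub>k\<close>, a series in even powers of \<open>x\<close>, while the left-hand side has the odd powers \<open>x u\<^sub>k\<close>.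
  By the arithmetic-geometric mean inequality each odd power is at most a combination of its two
  even neighbours, \<open>x \<le> (k+2) + x\<^sup>2 / (4 (k+2))\<close>, and the weight \<open>k + 2\<close> is the one for which the
  recurrence \<open>(k+2)\<^sup>2 u\<^sub>k\<^sub>+\<^sub>1 = (x/2)\<^sup>2 u\<^sub>k\<close> gives both neighbours the same coefficient:
  \<open>x u\<^sub>k \<le> (k+2) u\<^sub>k + (k+2) u\<^sub>k\<^sub>+\<^sub>1\<close>. Summed over \<open>k\<close>, the coefficient of \<open>u\<^sub>k\<close> on the right becomes
  \<open>(k+2) + (k+1) = 2k + 3\<close>, except that \<open>u\<^sub>0\<close> is counted once less, which only helps.
\<close>

definition bessel_I1 :: "real \<Rightarrow> real" where
  "bessel_I1 x = (\<Sum>k. (x / 2) ^ (2 * k + 1) / (fact k * fact (Suc k)))"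

definition bessel_term :: "real \<Rightarrow> nat \<Rightarrow> real" where
  "bessel_term x k = (x / 2) ^ (2 * Suc k) / (fact (Suc k))\<^sup>2"

text \<open>
  In the variable \<open>y = (x/2)\<^sup>2\<close> the function \<open>I\<^sub>0\<close> is an ordinary power series, with
  coefficients \<open>1 / (k!)\<^sup>2\<close>. These two lemmas carry the given summability over to that form, so that
  termwise differentiation of power series applies.
\<close>

lemma summable_inverse_fact_square:
  "summable (\<lambda>k. 1 / (fact k)\<^sup>2 * y ^ k :: real)"
proof -
  have "summable (\<lambda>k. 1 / (fact k)\<^sup>2 * \<bar>y\<bar> ^ k :: real)"
    using summable_bessel_I0[of "2 * sqrt \<bar>y\<bar>"] by (simp add: power_mult)
  then have "summable (\<lambda>k. \<bar>1 / (fact k)\<^sup>2 * y ^ k\<bar> :: real)"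
    by (simp add: abs_mult power_abs)
  then show ?thesis
    by (rule summable_rabs_cancel)
qed

lemma diffs_inverse_fact_square:
  "diffs (\<lambda>k. 1 / (fact k)\<^sup>2) k = (1 / (fact k * fact (Suc k)) :: real)"
  by (simp add: diffs_def power2_eq_square field_simps del: of_nat_Suc)

lemma bessel_I1_sums:
  "(\<lambda>k. (x / 2) ^ (2 * k + 1) / (fact k * fact (Suc k))) sums bessel_I1 x"
proof -
  have "summable (\<lambda>k. diffs (\<lambda>k. 1 / (fact k)\<^sup>2) k * ((x / 2)\<^sup>2) ^ k :: real)"
    by (rule termdiff_converges_all[OF summable_inverse_fact_square])
  then have "summable (\<lambda>k. (x / 2) * (diffs (\<lambda>k. 1 / (fact k)\<^sup>2) k * ((x / 2)\<^sup>2) ^ k))"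
    by (rule summable_mult)
  moreover have "(x / 2) * (diffs (\<lambda>k. 1 / (fact k)\<^sup>2) k * ((x / 2)\<^sup>2) ^ k)
      = (x / 2) ^ (2 * k + 1) / (fact k * fact (Suc k))" for k
    unfolding diffs_inverse_fact_square by (simp add: power_mult)
  ultimately show ?thesis
    unfolding bessel_I1_def by (simp only: summable_sums)
qed

lemma has_real_derivative_bessel_I0:
  "(bessel_I0 has_real_derivative bessel_I1 x) (at x)"
proof -
  define c :: "nat \<Rightarrow> real" where "c = (\<lambda>k. 1 / (fact k)\<^sup>2)"
  have I0: "bessel_I0 = (\<lambda>x. \<Sum>k. c k * ((x / 2)\<^sup>2) ^ k)"
    by (simp add: fun_eq_iff bessel_I0_def c_def power_mult)
  have "((\<lambda>y. \<Sum>k. c k * y ^ k) has_real_derivative (\<Sum>k. diffs c k * ((x / 2)\<^sup>2) ^ k))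
      (at ((x / 2)\<^sup>2))"
    unfolding c_def by (rule termdiffs_strong_converges_everywhere[OF summable_inverse_fact_square])
  moreover have "((\<lambda>x. (x / 2)\<^sup>2) has_real_derivative x / 2) (at x)"
    by (auto intro!: derivative_eq_intros)
  ultimately have "(bessel_I0 has_real_derivative
      (\<Sum>k. diffs c k * ((x / 2)\<^sup>2) ^ k) * (x / 2)) (at x)"
    unfolding I0 by (rule DERIV_chain2)
  moreover have "(\<Sum>k. diffs c k * ((x / 2)\<^sup>2) ^ k) * (x / 2) = bessel_I1 x"
  proof -
    have "summable (\<lambda>k. diffs c k * ((x / 2)\<^sup>2) ^ k)"
      unfolding c_def by (rule termdiff_converges_all[OF summable_inverse_fact_square])
    then have "(\<Sum>k. diffs c k * ((x / 2)\<^sup>2) ^ k) * (x / 2)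
        = (\<Sum>k. diffs c k * ((x / 2)\<^sup>2) ^ k * (x / 2))"
      by (rule suminf_mult2)
    also have "\<dots> = bessel_I1 x"
      unfolding bessel_I1_def c_def diffs_inverse_fact_square
      by (simp add: power_mult[symmetric] mult.commute)
    finally show ?thesis .
  qed
  ultimately show ?thesis by simp
qed

lemma bessel_term_sums: "bessel_term x sums (bessel_I0 x - 1)"
proof -
  have "(\<lambda>k. (x / 2) ^ (2 * k) / (fact k)\<^sup>2) sums bessel_I0 x"
    unfolding bessel_I0_def by (rule summable_sums[OF summable_bessel_I0])
  then show ?thesis
    unfolding bessel_term_def by (subst sums_Suc_iff) simp
qed

lemma weighted_bessel_term_sums:
  "(\<lambda>k. 2 * real (Suc k) * bessel_term x k) sums (x * bessel_I1 x)"
proof -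
  have "2 * real (Suc k) * bessel_term x k
      = x * ((x / 2) ^ (2 * k + 1) / (fact k * fact (Suc k)))" for k
    by (simp add: bessel_term_def power2_eq_square field_simps del: of_nat_Suc)
  then show ?thesis
    using sums_mult[OF bessel_I1_sums, of x x] by simp
qed

lemma bessel_term_nonneg: "0 \<le> bessel_term x k"
  unfolding bessel_term_def by (simp only: power_mult) simp

lemma bessel_term_Suc:
  "(real k + 2)\<^sup>2 * bessel_term x (Suc k) = (x / 2)\<^sup>2 * bessel_term x k"
proof -
  have "(fact (Suc (Suc k)) :: real) = (real k + 2) * fact (Suc k)"
    by simp
  moreover have "real k + 2 \<noteq> 0" by simp
  ultimately show ?thesis
    unfolding bessel_term_def
    by (simp add: power_mult_distrib power2_eq_square del: fact_Suc)
qed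

text \<open>
  The right-hand side exceeds the left-hand side by \<open>u\<^sub>k (x - 2 (k+2))\<^sup>2 / (4 (k+2))\<close>.
\<close>

lemma mult_bessel_term_le:
  "x * bessel_term x k \<le> (real k + 2) * bessel_term x k + (real k + 2) * bessel_term x (Suc k)"
proof -
  define m where "m = real k + 2"
  have m: "m > 0" by (simp add: m_def)
  have "m * (m * bessel_term x k + m * bessel_term x (Suc k) - x * bessel_term x k)
      = m\<^sup>2 * bessel_term x k + m\<^sup>2 * bessel_term x (Suc k) - m * x * bessel_term x k"
    by (simp add: algebra_simps power2_eq_square)
  also have "\<dots> = (m - x / 2)\<^sup>2 * bessel_term x k"
    unfolding m_def bessel_term_Suc by (simp add: algebra_simps power2_eq_square)
  also have "\<dots> \<ge> 0"
    by (simp add: bessel_term_nonneg)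
  finally show ?thesis
    using m by (simp add: zero_le_mult_iff m_def)
qed

lemma mult_bessel_I0_minus_1_le:
  "x * (bessel_I0 x - 1) \<le> (bessel_I0 x - 1) + x * bessel_I1 x"
proof -
  let ?u = "bessel_term x"
  define S where "S = bessel_I0 x - 1"
  define T where "T = x * bessel_I1 x"
  have S: "?u sums S"
    unfolding S_def by (rule bessel_term_sums)
  have T: "(\<lambda>k. real (Suc k) * ?u k) sums (T / 2)"
    using sums_divide[OF weighted_bessel_term_sums, of x 2]
    by (simp add: T_def mult.assoc del: of_nat_Suc)
  have same: "(\<lambda>k. (real k + 2) * ?u k) sums (T / 2 + S)"
    using sums_add[OF T S] by (simp add: algebra_simps)
  \<comment> \<open>The shifted series lacks only the term of index 0, which is \<open>u\<^sub>0\<close>.\<close>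
  have shifted: "(\<lambda>k. (real k + 2) * ?u (Suc k)) sums (T / 2 - ?u 0)"
    using T sums_Suc_iff[of "\<lambda>k. real (Suc k) * ?u k" "T / 2 - ?u 0"]
    by (simp add: add.commute)
  have "x * S \<le> (T / 2 + S) + (T / 2 - ?u 0)"
    by (rule sums_le[OF mult_bessel_term_le sums_mult[OF S] sums_add[OF same shifted]])
  also have "\<dots> \<le> S + T"
    using bessel_term_nonneg[of x 0] by simp
  finally show ?thesis
    by (simp add: S_def T_def)
qed

lemma bessel_I0_gt_1:
  assumes "x \<noteq> 0"
  shows "1 < bessel_I0 x"
proof -
  have "0 < bessel_term x 0"
    using assms by (simp add: bessel_term_def)
  also have "bessel_term x 0 \<le> bessel_I0 x - 1"
    using sums_le[OF _ sums_If_finite_set[of "{0}" "bessel_term x"] bessel_term_sums]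
    by (simp add: bessel_term_nonneg)
  finally show ?thesis by simp
qed

lemma mono_mult_bessel_I0_minus_1_exp_minus:
  "mono (\<lambda>x. x * (bessel_I0 x - 1) * exp (- x))"
proof (rule monoI)
  fix a b :: real
  assume "a \<le> b"
  then show "a * (bessel_I0 a - 1) * exp (- a) \<le> b * (bessel_I0 b - 1) * exp (- b)"
  proof (rule DERIV_nonneg_imp_nondecreasing)
    fix x :: real
    let ?D = "exp (- x) * ((bessel_I0 x - 1) + x * bessel_I1 x - x * (bessel_I0 x - 1))"
    have "((\<lambda>x. x * (bessel_I0 x - 1) * exp (- x)) has_real_derivative ?D) (at x)"
      by (auto intro!: derivative_eq_intros has_real_derivative_bessel_I0 simp: algebra_simps)
    moreover have "0 \<le> ?D"
      using mult_bessel_I0_minus_1_le[of x] by simp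
    ultimately show "\<exists>y. ((\<lambda>x. x * (bessel_I0 x - 1) * exp (- x)) has_real_derivative y) (at x)
        \<and> 0 \<le> y"
      by blast
  qed
qed

theorem lemma5p2:
  shows "antimono_on {1..} (\<lambda>x::real. exp x / (x * (bessel_I0 x - 1)))"
proof (rule monotone_onI)
  fix a b :: real
  assume a: "a \<in> {1..}" and b: "b \<in> {1..}" and "a \<le> b"
  let ?h = "\<lambda>x. x * (bessel_I0 x - 1) * exp (- x)"
  have eq: "exp x / (x * (bessel_I0 x - 1)) = 1 / ?h x" for x :: real
    by (simp add: exp_minus field_simps)
  have "?h a \<le> ?h b"
    using mono_mult_bessel_I0_minus_1_exp_minus \<open>a \<le> b\<close> by (rule monoD)
  moreover have "0 < ?h a"
    using a bessel_I0_gt_1[of a] by simp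
  ultimately show "exp b / (b * (bessel_I0 b - 1)) \<le> exp a / (a * (bessel_I0 a - 1))"
    unfolding eq by (rule frac_le[OF zero_le_one order_refl, rotated])
qed

end
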